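(* Let $n\ge 2$, $p=n(n+1)/2$, $T_0=4\ln(p)$, let $\mathcal S\subset\mathbb Z_+^n$ be a finite nonempty set of configurations with a fixed tie-breaking order, and let $D=\max_{(u,v)\in\mathcal S^2}\|u-v\|_\infty$. Consider an expert projective cone scheduler with parameter array $b$, and let $(y_1,s_1),(y_2,s_2),\dots$ be the observed normalized backlogs and expert decisions, $s_t=\mu(y_t;b)$. Run the unknown-horizon multiplicative-weights algorithm (Algorithm 2 in the context) on these observations, and let $\ell_t$ be the resulting losses. Write $\lg(\cdot)=\lceil\log_2(\cdot)\rceil$ and, for integers $T\ge T_0$ and $\epsilon>0$, let $$f_T(\epsilon)=\frac1T\left|\left\{t\in\{1,\dots,T\}:\ \ell_t>2\sqrt2\,D\,\lg\!\left(\frac{2T}{T_0}\right)\sqrt{\frac{\ln(p)}{T}}+\epsilon\right\}\right|.$$ Then for every $\epsilon>0$ and every integer $T\ge T_0$, $$f_T(\epsilon)\le 1-\frac{\epsilon}{2\sqrt2\,D\,\lg\!\left(\frac{2T}{T_0}\right)\sqrt{\frac{\ln(p)}{T}}+\epsilon},$$ and hence $\lim_{T\to\infty}f_T(\epsilon)=0$.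
   Context: Notation: $\mathbb Z_+=\{0,1,2,\dots\}$, $[n]=\{1,\dots,n\}$. "Array" means a real array indexed by pairs $(i,j)\in[n]^2$ with $i\le j$ (so it has $p=n(n+1)/2$ entries). $\sigma(i,j)=1$ if $i=j$ and $-1$ if $i\ne j$. For $u,y\in\mathbb R^n$ and $i\le j$ put $q_{ij}(u,y)=u(i)y(i)$ if $i=j$ and $q_{ij}(u,y)=u(i)y(j)+u(j)y(i)$ if $i<j$. Queueing model: backlogs $x_t\in\mathbb Z_+^n$ satisfy $x_{t+1}=x_t-d_t+a_t$ with $x_0\in\mathbb Z_+^n$ arbitrary, $d_t=\min\{s_t,x_t\}$ componentwise, where $s_t\in\mathcal S$ is the expert's configuration, and arrivals $a_t\in\mathbb Z_+^n$ that are arbitrary (they may depend arbitrarily on past backlogs, arrivals and configurations). The normalized backlog is $y_t=x_t/\|x_t\|_1$ if $\|x_t\|_1\neq0$ and $y_t=0$ otherwise. Scheduler: for an array $\beta$ and $y\in\mathbb R_+^n$, $$\mu(y;\beta)=\arg\max_{s\in\mathcal S}\sum_{i\le j}\sigma(i,j)\,\beta(i,j)\,q_{ij}(s,y),$$ with ties broken by the fixed ordering of $\mathcal S$. The expert is given by a symmetric positive-definite $B\in\mathbb R^{n\times n}$ with non-positive off-diagonal entries, and chooses $s_t=\arg\max_{s\in\mathcal S}\langle s,Bx_t\rangle$ (same tie-breaking). Its array $b$ is $b(i,i)=cB(i,i)$ and $b(i,j)=-cB(i,j)$ for $i<j$, with $c>0$ chosen so that $\sum_{i\le j}b(i,j)=1$;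 thus $b\ge0$ and $s_t=\mu(x_t;b)=\mu(y_t;b)$. Algorithm 2: let $T_{-1}=0$ and $T_k=2^k\cdot4\ln(p)$ for $k\ge0$. The learning rate at time $t\ge1$ is $\eta_t=\sqrt{\ln(p)/T_k}$ if $T_k<t\le T_{k+1}$ with $k\ge0$, and $\eta_t=\sqrt{\ln(p)/T_0}=1/2$ if $0<t\le T_0$ (i.e. in each epoch $(T_k,T_{k+1}]$ the horizon parameter is the epoch length $T_{k+1}-T_k$). Set $w_1(i,j)=1$ for all $i\le j$; the weights are never re-initialized. For $t=1,2,\dots$: set $\hat b_t=w_t/\sum_{i\le j}w_t(i,j)$, $\hat s_t=\mu(y_t;\hat b_t)$, $\delta_t=\hat s_t-s_t$. If $\delta_t=0$ let $m_t=0$; otherwise let $z_t=\delta_t/\|\delta_t\|_\infty$ and $m_t(i,j)=\sigma(i,j)\,q_{ij}(z_t,y_t)$ for $i\le j$. Update $w_{t+1}(i,j)=w_t(i,j)(1-\eta_t\, m_t(i,j))$. Loss: $\ell_t=\sum_{i\le j}\sigma(i,j)\,(\hat b_t(i,j)-b(i,j))\,q_{ij}(\delta_t,y_t)$. *)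

theory Defs
  imports "HOL-Analysis.Analysis"
begin

section \<open>Configurations and arrays\<close>

text \<open>
  The index set \<open>{1, \<dots>, n}\<close> is a finite linearly ordered type \<open>'n\<close>, with \<open>n = CARD('n)\<close>.
  The synonyms abbreviate the usual \<open>nat ^ 'n\<close> etc.: the infix form would
  impose sort \<open>finite\<close> at each occurrence. An array is a function
  \<open>'n \<Rightarrow> 'n \<Rightarrow> real\<close> of which only the entries in \<open>upper\<close> are ever used.
\<close>

type_synonym 'n nvec = "(nat, 'n) vec"
type_synonym 'n rvec = "(real, 'n) vec"
type_synonym 'n rmat = "((real, 'n) vec, 'n) vec"
type_synonym 'n array = "'n \<Rightarrow> 'n \<Rightarrow> real"

definition upper :: "('n::{finite,linorder} \<times> 'n) set" where
  "upper = {(i, j). i \<le> j}"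

definition num_entries :: "nat \<Rightarrow> nat" where
  "num_entries n = n * (n + 1) div 2"

definition real_vec :: "('n::finite) nvec \<Rightarrow> 'n rvec" where
  "real_vec x = (\<chi> i. real (x $ i))"

definition normalized :: "('n::finite) nvec \<Rightarrow> 'n rvec" where
  "normalized x =
     (if (\<Sum>i\<in>UNIV. x $ i) \<noteq> 0 then real_vec x /\<^sub>R real (\<Sum>i\<in>UNIV. x $ i) else 0)"

definition sgn_ij :: "'n \<Rightarrow> 'n \<Rightarrow> real" where
  "sgn_ij i j = (if i = j then 1 else -1)"

definition q_ij :: "'n::finite \<Rightarrow> 'n \<Rightarrow> 'n rvec \<Rightarrow> 'n rvec \<Rightarrow> real" where
  "q_ij i j u y = (if i = j then u $ i * y $ i else u $ i * y $ j + u $ j * y $ i)"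

definition score :: "('n::{finite,linorder}) array \<Rightarrow> 'n rvec \<Rightarrow> 'n rvec \<Rightarrow> real" where
  "score \<beta> u y = (\<Sum>(i, j)\<in>upper. sgn_ij i j * \<beta> i j * q_ij i j u y)"

section \<open>Schedulers\<close>

text \<open>
  The tie-breaking order \<open>r\<close> is a linear order on \<open>S\<close>; among the maximizers, the least one
  is chosen.
\<close>

definition maximizers :: "'a set \<Rightarrow> ('a \<Rightarrow> real) \<Rightarrow> 'a set" where
  "maximizers S g = {s \<in> S. \<forall>s'\<in>S. g s' \<le> g s}"

definition argmax_tie :: "'a set \<Rightarrow> 'a rel \<Rightarrow> ('a \<Rightarrow> real) \<Rightarrow> 'a" where
  "argmax_tie S r g =
     (THE s. s \<in> maximizers S g \<and> (\<forall>s'\<in>maximizers S g. (s, s') \<in> r))"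

definition scheduler ::
  "'n nvec set \<Rightarrow> 'n nvec rel \<Rightarrow> 'n rvec \<Rightarrow> ('n::{finite,linorder}) array \<Rightarrow> 'n nvec" where
  "scheduler S r y \<beta> = argmax_tie S r (\<lambda>s. score \<beta> (real_vec s) y)"

definition pos_def_matrix :: "('n::finite) rmat \<Rightarrow> bool" where
  "pos_def_matrix B \<longleftrightarrow> transpose B = B \<and> (\<forall>v. v \<noteq> 0 \<longrightarrow> v \<bullet> (B *v v) > 0)"

definition expert_decision ::
  "('n::finite) nvec set \<Rightarrow> 'n nvec rel \<Rightarrow> 'n rmat \<Rightarrow> 'n nvec \<Rightarrow> 'n nvec" where
  "expert_decision S r B x = argmax_tie S r (\<lambda>s. real_vec s \<bullet> (B *v real_vec x))"

definition expert_array :: "real \<Rightarrow> ('n::finite) rmat \<Rightarrow> 'n array" where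
  "expert_array c B i j = (if i = j then c * B $ i $ i else - c * B $ i $ j)"

definition diam_inf :: "('n::finite) nvec set \<Rightarrow> real" where
  "diam_inf S = Max ((\<lambda>(u, v). infnorm (real_vec u - real_vec v)) ` (S \<times> S))"

section \<open>Multiplicative weights with unknown horizon\<close>

definition epoch_end :: "nat \<Rightarrow> nat \<Rightarrow> real" where
  "epoch_end p k = 2 ^ k * (4 * ln (real p))"

definition learning_rate :: "nat \<Rightarrow> nat \<Rightarrow> real" where
  "learning_rate p t =
     (if real t \<le> epoch_end p 0 then sqrt (ln (real p) / epoch_end p 0)
      else sqrt (ln (real p) /
        epoch_end p (THE k. epoch_end p k < real t \<and> real t \<le> epoch_end p (Suc k))))"

definition normalized_array :: "('n::{finite,linorder}) array \<Rightarrow> 'n array" where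
  "normalized_array w i j = w i j / (\<Sum>(k, l)\<in>upper. w k l)"

text \<open>
  \<open>decision_gap\<close> and \<open>mw_feedback\<close> are \<open>\<delta>\<^sub>t\<close> and \<open>m\<^sub>t\<close> for a given
  weight array \<open>w\<close>, backlog \<open>y\<close> and expert decision \<open>s\<close>.
\<close>

definition decision_gap ::
  "'n nvec set \<Rightarrow> 'n nvec rel \<Rightarrow> ('n::{finite,linorder}) array \<Rightarrow> 'n rvec \<Rightarrow> 'n nvec
    \<Rightarrow> 'n rvec" where
  "decision_gap S r w y s = real_vec (scheduler S r y (normalized_array w)) - real_vec s"

definition mw_feedback :: "('n::finite) rvec \<Rightarrow> 'n rvec \<Rightarrow> 'n array" where
  "mw_feedback \<delta> y i j =
     (if \<delta> = 0 then 0 else sgn_ij i j * q_ij i j (\<delta> /\<^sub>R infnorm \<delta>) y)"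

text \<open>Time starts at 1; the value at index 0 is a dummy.\<close>

fun mw_weights ::
  "'n nvec set \<Rightarrow> 'n nvec rel \<Rightarrow> (nat \<Rightarrow> 'n rvec) \<Rightarrow> (nat \<Rightarrow> 'n nvec) \<Rightarrow> nat
    \<Rightarrow> ('n::{finite,linorder}) array" where
  "mw_weights S r y s 0 = (\<lambda>i j. 1)"
| "mw_weights S r y s (Suc 0) = (\<lambda>i j. 1)"
| "mw_weights S r y s (Suc (Suc t)) =
     (let t' = Suc t; w = mw_weights S r y s t';
          m = mw_feedback (decision_gap S r w (y t') (s t')) (y t')
      in (\<lambda>i j. w i j * (1 - learning_rate (num_entries CARD('n)) t' * m i j)))"

definition mw_loss ::
  "'n nvec set \<Rightarrow> 'n nvec rel \<Rightarrow> ('n::{finite,linorder}) array \<Rightarrow> (nat \<Rightarrow> 'n rvec)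
    \<Rightarrow> (nat \<Rightarrow> 'n nvec) \<Rightarrow> nat \<Rightarrow> real" where
  "mw_loss S r b y s t =
     (let w = mw_weights S r y s t in
      \<Sum>(i, j)\<in>upper. sgn_ij i j * (normalized_array w i j - b i j) *
        q_ij i j (decision_gap S r w (y t) (s t)) (y t))"

definition loss_threshold :: "nat \<Rightarrow> real \<Rightarrow> nat \<Rightarrow> real" where
  "loss_threshold p D T =
     2 * sqrt 2 * D * real_of_int \<lceil>log 2 (2 * real T / epoch_end p 0)\<rceil>
       * sqrt (ln (real p) / real T)"

definition excess_fraction :: "nat \<Rightarrow> real \<Rightarrow> (nat \<Rightarrow> real) \<Rightarrow> nat \<Rightarrow> real \<Rightarrow> real" where
  "excess_fraction p D l T \<epsilon> =
     real (card {t \<in> {1..T}. l t > loss_threshold p D T + \<epsilon>}) / real T"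

section \<open>Consistency of the expert with the array scheduler\<close>

lemma argmax_tie_unique:
  assumes "finite S" "S \<noteq> {}" "linear_order_on S r"
  shows "\<exists>!s. s \<in> maximizers S g \<and> (\<forall>s'\<in>maximizers S g. (s, s') \<in> r)"
proof -
  have M: "finite M \<Longrightarrow> M \<noteq> {} \<Longrightarrow> M \<subseteq> S \<Longrightarrow> \<exists>s\<in>M. \<forall>s'\<in>M. (s, s') \<in> r" for M
  proof (induction M rule: finite_ne_induct)
    case (singleton a)
    then show ?case
      using assms(3) by (auto simp: order_on_defs refl_on_def)
  next
    case (insert a F)
    then obtain s where s: "s \<in> F" "\<forall>s'\<in>F. (s, s') \<in> r" by auto
    have "trans r" "refl_on S r" "total_on S r"
      using assms(3) by (auto simp: order_on_defs)
    moreover have "a \<in> S" "s \<in> S" "a \<noteq> s"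
      using insert s by auto
    ultimately have cmp: "(a, s) \<in> r \<or> (s, a) \<in> r" and aa: "(a, a) \<in> r" and tr: "trans r"
      by (auto simp: total_on_def refl_on_def)
    from cmp show ?case
    proof
      assume "(a, s) \<in> r"
      then have "\<forall>s'\<in>insert a F. (a, s') \<in> r"
        using s(2) aa tr by (blast dest: transD)
      then show ?thesis by blast
    next
      assume "(s, a) \<in> r"
      then show ?thesis using s by blast
    qed
  qed
  have "Max (g ` S) \<in> g ` S"
    using assms by auto
  then obtain s where "s \<in> S" "g s = Max (g ` S)"
    by auto
  then have "s \<in> maximizers S g"
    using assms by (auto simp: maximizers_def)
  moreover have "maximizers S g \<subseteq> S"
    by (auto simp: maximizers_def)
  ultimately obtain m where "m \<in> maximizers S g" "\<forall>s'\<in>maximizers S g. (m, s') \<in> r"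
    using M[of "maximizers S g"] assms(1) finite_subset by (metis empty_iff)
  moreover have "antisym r"
    using assms(3) by (auto simp: order_on_defs)
  ultimately show ?thesis
    by (auto dest: antisymD)
qed

lemma score_expert_array:
  fixes B :: "('n::{finite,linorder}) rmat"
  assumes "transpose B = B"
  shows "score (expert_array c B) u y = c * (u \<bullet> (B *v y))"
proof -
  have sym: "B $ i $ j = B $ j $ i" for i j
    using assms by (metis transpose_def vec_lambda_beta)
  let ?f = "\<lambda>(i, j). u $ i * (B $ i $ j * y $ j)"
  let ?D = "{(i, j). i = j} :: ('n \<times> 'n) set"
  let ?U = "{(i, j). i < j} :: ('n \<times> 'n) set"
  let ?L = "{(i, j). j < i} :: ('n \<times> 'n) set"
  have "u \<bullet> (B *v y) = sum ?f UNIV"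
    by (simp add: inner_vec_def matrix_vector_mult_def sum_distrib_left sum.cartesian_product)
  also have "UNIV = ?D \<union> (?U \<union> ?L)"
    by auto
  also have "sum ?f (?D \<union> (?U \<union> ?L)) = sum ?f ?D + (sum ?f ?U + sum ?f ?L)"
    by (subst sum.union_disjoint; (subst sum.union_disjoint)?) auto
  also have "sum ?f ?L = (\<Sum>(i, j)\<in>?U. u $ j * (B $ j $ i * y $ i))"
    by (rule sum.reindex_bij_witness[of _ prod.swap prod.swap]) auto
  finally have "c * (u \<bullet> (B *v y)) =
      c * sum ?f ?D + (c * sum ?f ?U + c * (\<Sum>(i, j)\<in>?U. u $ j * (B $ j $ i * y $ i)))"
    by (simp add: algebra_simps)
  moreover have "score (expert_array c B) u y =
      (\<Sum>(i, j)\<in>?D \<union> ?U. sgn_ij i j * expert_array c B i j * q_ij i j u y)"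
    unfolding score_def upper_def by (rule sum.cong) auto
  moreover have "\<dots> = (\<Sum>(i, j)\<in>?D. sgn_ij i j * expert_array c B i j * q_ij i j u y)
      + (\<Sum>(i, j)\<in>?U. sgn_ij i j * expert_array c B i j * q_ij i j u y)"
    by (rule sum.union_disjoint) auto
  moreover have "(\<Sum>(i, j)\<in>?D. sgn_ij i j * expert_array c B i j * q_ij i j u y) = c * sum ?f ?D"
    unfolding sum_distrib_left
    by (rule sum.cong) (auto simp: sgn_ij_def expert_array_def q_ij_def)
  moreover have "(\<Sum>(i, j)\<in>?U. sgn_ij i j * expert_array c B i j * q_ij i j u y)
      = c * sum ?f ?U + c * (\<Sum>(i, j)\<in>?U. u $ j * (B $ j $ i * y $ i))"
    unfolding sum_distrib_left sum.distrib[symmetric]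
    by (rule sum.cong) (auto simp: sgn_ij_def expert_array_def q_ij_def sym algebra_simps)
  ultimately show ?thesis
    by simp
qed

lemma expert_decision_eq_scheduler:
  fixes B :: "('n::{finite,linorder}) rmat"
  assumes "pos_def_matrix B" "c > 0"
  shows "expert_decision S r B x = scheduler S r (normalized x) (expert_array c B)"
proof -
  let ?N = "\<Sum>i\<in>UNIV. x $ i"
  have eq: "score (expert_array c B) u (normalized x) = c * (u \<bullet> (B *v normalized x))" for u
    using assms score_expert_array by (auto simp: pos_def_matrix_def)
  have "\<exists>k>0. \<forall>u. score (expert_array c B) u (normalized x) = k * (u \<bullet> (B *v real_vec x))"
  proof (cases "?N = 0")
    case True
    then have "real_vec x = 0" "normalized x = 0"
      by (auto simp: real_vec_def normalized_def vec_eq_iff)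
    then show ?thesis
      using eq by (intro exI[of _ 1]) auto
  next
    case False
    then have "c * (u \<bullet> (B *v normalized x)) = (c / real ?N) * (u \<bullet> (B *v real_vec x))" for u
      by (simp add: normalized_def matrix_vector_mult_scaleR divide_inverse del: of_nat_sum)
    moreover have "c / real ?N > 0"
      using False assms(2) by (metis divide_pos_pos neq0_conv of_nat_0_less_iff)
    ultimately show ?thesis
      using eq by metis
  qed
  then obtain k where "k > 0" and
    "\<And>u. score (expert_array c B) u (normalized x) = k * (u \<bullet> (B *v real_vec x))"
    by blast
  then have "maximizers S (\<lambda>s. score (expert_array c B) (real_vec s) (normalized x)) =
      maximizers S (\<lambda>s. real_vec s \<bullet> (B *v real_vec x))"
    by (auto simp: maximizers_def)
  then show ?thesis
    by (simp add: expert_decision_def scheduler_def argmax_tie_def)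
qed

end

theory Submission
  imports Defs "HOL-Real_Asymp.Real_Asymp"
begin

text \<open>
  Write \<open>g\<^sub>t\<close> for the inner product of \<open>m\<^sub>t\<close> with the difference between the learner's and
  the expert's array. Both schedulers maximize their own score, so \<open>g\<^sub>t \<ge> 0\<close>
  and \<open>0 \<le> l\<^sub>t \<le> D g\<^sub>t\<close>. The relative-entropy potential gives
  \<open>\<Sum> \<eta>\<^sub>t g\<^sub>t \<le> ln p + \<Sum> \<eta>\<^sub>t\<^sup>2\<close>. As the learning rate is non-increasing and \<open>g\<close> non-negative,
  the left side is at least \<open>\<eta>\<^sub>T \<Sum> g\<^sub>t\<close>; this is why the weights need no re-initialization
  at epoch boundaries. Each epoch contributes at most about \<open>ln p\<close> to \<open>\<Sum> \<eta>\<^sub>t\<^sup>2\<close>, so the average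
  loss is at most the threshold, and Markov's inequality bounds the number of excesses.
\<close>

section \<open>Multiplicative weights with a varying learning rate\<close>

text \<open>The difference \<open>f\<close> of the two sides has derivative
  \<open>z * (1 - 2 * z) / (1 - z)\<close>, nonpositive left of 0 and nonnegative between 0 and 1/2,
  so \<open>f\<close> is smallest at 0, where it vanishes.\<close>

lemma ln_one_minus_lower_bound:
  fixes x :: real
  assumes "x \<le> 1 / 2"
  shows "- x - x\<^sup>2 \<le> ln (1 - x)"
proof -
  define f where "f = (\<lambda>x::real. ln (1 - x) + x + x\<^sup>2)"
  have deriv: "(f has_real_derivative z * (1 - 2 * z) / (1 - z)) (at z)" if "z \<le> 1 / 2" for z
    unfolding f_def using that
    by (auto intro!: derivative_eq_intros simp: field_simps power2_eq_square)
  have "f 0 \<le> f x"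
  proof (cases "x \<ge> 0")
    case True
    show ?thesis
    proof (rule DERIV_nonneg_imp_nondecreasing[OF True])
      fix z assume "0 \<le> z" "z \<le> x"
      with assms deriv[of z] show "\<exists>d. (f has_real_derivative d) (at z) \<and> 0 \<le> d"
        by (intro exI[of _ "z * (1 - 2 * z) / (1 - z)"]) auto
    qed
  next
    case False
    then have "x \<le> 0" by simp
    then show ?thesis
    proof (rule DERIV_nonpos_imp_nonincreasing)
      fix z assume "x \<le> z" "z \<le> 0"
      with deriv[of z] show "\<exists>d. (f has_real_derivative d) (at z) \<and> d \<le> 0"
        by (intro exI[of _ "z * (1 - 2 * z) / (1 - z)"])
          (auto intro!: divide_nonpos_pos mult_nonpos_nonneg)
    qed
  qed
  then show ?thesis
    by (simp add: f_def)
qed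

text \<open>Each round is treated on its own: the potential rises by at least
  \<open>\<eta> t * g t - (\<eta> t)\<^sup>2\<close>, starts at \<open>- ln (card I)\<close> and
  ends nonpositive. Keeping \<open>\<eta> t\<close> inside the sum lets it vary with
  \<open>t\<close>.\<close>

lemma mw_regret:
  fixes w m :: "nat \<Rightarrow> 'a \<Rightarrow> real" and \<eta> :: "nat \<Rightarrow> real" and b :: "'a \<Rightarrow> real"
  assumes "finite I" "I \<noteq> {}"
    and init: "\<And>i. i \<in> I \<Longrightarrow> w 1 i = 1"
    and step: "\<And>t i. t \<ge> 1 \<Longrightarrow> i \<in> I \<Longrightarrow> w (Suc t) i = w t i * (1 - \<eta> t * m t i)"
    and m: "\<And>t i. i \<in> I \<Longrightarrow> \<bar>m t i\<bar> \<le> 1"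
    and \<eta>: "\<And>t. 0 < \<eta> t" "\<And>t. \<eta> t \<le> 1 / 2"
    and b: "\<And>i. i \<in> I \<Longrightarrow> b i \<ge> 0" "sum b I = 1"
  shows "(\<Sum>t=1..T. \<eta> t * (\<Sum>i\<in>I. (w t i / sum (w t) I - b i) * m t i))
           \<le> ln (card I) + (\<Sum>t=1..T. (\<eta> t)\<^sup>2)"
proof -
  \<comment> \<open>Up to a constant depending on \<open>b\<close>, this is minus the relative
    entropy of \<open>b\<close> with respect to the normalized weights; leaving that constant out
    avoids logarithms of vanishing entries of \<open>b\<close>.\<close>
  define \<Psi> where "\<Psi> = (\<lambda>t. \<Sum>i\<in>I. b i * ln (w t i / sum (w t) I))"
  define g where "g = (\<lambda>t. \<Sum>i\<in>I. (w t i / sum (w t) I - b i) * m t i)"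
  have small: "\<bar>\<eta> t * m t i\<bar> \<le> 1 / 2" if "i \<in> I" for t i
  proof -
    have "\<eta> t * \<bar>m t i\<bar> \<le> (1 / 2) * 1"
      using m[OF that] \<eta>(1)[of t] \<eta>(2)[of t] by (intro mult_mono) auto
    then show ?thesis
      using \<eta>(1)[of t] by (simp add: abs_mult)
  qed
  have factor_pos: "1 - \<eta> t * m t i > 0" if "i \<in> I" for t i
    using small[OF that, of t] by linarith
  have pos: "w t i > 0" if "t \<ge> 1" "i \<in> I" for t i
    using that(1)
  proof (induction t rule: dec_induct)
    case base
    then show ?case using init that by simp
  next
    case (step t)
    then show ?case using assms(4) factor_pos that by simp
  qed
  have W_pos: "sum (w t) I > 0" if "t \<ge> 1" for t
    using pos that assms(1,2) by (intro sum_pos) auto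
  have inc: "\<Psi> (Suc t) - \<Psi> t \<ge> \<eta> t * g t - (\<eta> t)\<^sup>2" if t: "t \<ge> 1" for t
  proof -
    define W where "W = sum (w t) I"
    define h where "h = (\<Sum>i\<in>I. w t i / W * m t i)"
    have W: "W > 0"
      using W_pos t by (simp add: W_def)
    \<comment> \<open>The total weight is multiplied by the factor belonging to the learner's
      average feedback \<open>h\<close>.\<close>
    have W': "sum (w (Suc t)) I = W * (1 - \<eta> t * h)"
    proof -
      have "sum (w (Suc t)) I = (\<Sum>i\<in>I. w t i - W * (\<eta> t * (w t i / W * m t i)))"
        using W t by (intro sum.cong) (auto simp: step field_simps)
      then show ?thesis
        by (simp add: sum_subtractf h_def sum_distrib_left W_def algebra_simps)
    qed
    have h1: "1 - \<eta> t * h > 0"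
      using W_pos[of "Suc t"] W W' by (simp add: zero_less_mult_iff)
    have "\<Psi> (Suc t) - \<Psi> t = (\<Sum>i\<in>I. b i * (ln (1 - \<eta> t * m t i) - ln (1 - \<eta> t * h)))"
      unfolding \<Psi>_def sum_subtractf[symmetric]
    proof (rule sum.cong[OF refl])
      fix i assume i: "i \<in> I"
      have new: "ln (w (Suc t) i / sum (w (Suc t)) I)
          = ln (w t i) + ln (1 - \<eta> t * m t i) - (ln W + ln (1 - \<eta> t * h))"
        using pos[OF t i] factor_pos[OF i, of t] W h1 step[OF t i] W'
        by (simp add: ln_mult ln_div)
      have old: "ln (w t i / sum (w t) I) = ln (w t i) - ln W"
        using pos[OF t i] W by (simp add: ln_div W_def)
      show "b i * ln (w (Suc t) i / sum (w (Suc t)) I) - b i * ln (w t i / sum (w t) I)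
          = b i * (ln (1 - \<eta> t * m t i) - ln (1 - \<eta> t * h))"
        unfolding new old by (simp add: algebra_simps)
    qed
    \<comment> \<open>The quadratic bound handles the factor of coordinate \<open>i\<close>, the
      tangent bound \<open>ln z \<le> z - 1\<close> the normalizer;
      \<open>\<bar>m t i\<bar> \<le> 1\<close> reduces the second-order error to
      \<open>(\<eta> t)\<^sup>2\<close>.\<close>
    also have "\<dots> \<ge> (\<Sum>i\<in>I. b i * (- \<eta> t * m t i - (\<eta> t)\<^sup>2 + \<eta> t * h))"
    proof (rule sum_mono, rule mult_left_mono)
      fix i assume i: "i \<in> I"
      have "ln (1 - \<eta> t * m t i) \<ge> - (\<eta> t * m t i) - (\<eta> t * m t i)\<^sup>2"
        using small[OF i, of t] by (intro ln_one_minus_lower_bound) linarith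
      moreover have "(\<eta> t * m t i)\<^sup>2 \<le> (\<eta> t)\<^sup>2"
        using m[OF i, of t] by (simp add: power_mult_distrib mult_left_le abs_square_le_1)
      moreover have "ln (1 - \<eta> t * h) \<le> - (\<eta> t * h)"
        using ln_le_minus_one[OF h1] by simp
      ultimately show "- \<eta> t * m t i - (\<eta> t)\<^sup>2 + \<eta> t * h
          \<le> ln (1 - \<eta> t * m t i) - ln (1 - \<eta> t * h)"
        by simp
    qed (use b in auto)
    also have "(\<Sum>i\<in>I. b i * (- \<eta> t * m t i - (\<eta> t)\<^sup>2 + \<eta> t * h))
        = - \<eta> t * (\<Sum>i\<in>I. b i * m t i) + sum b I * (\<eta> t * h - (\<eta> t)\<^sup>2)"
      by (simp add: sum_distrib_left sum_distrib_right sum.distrib[symmetric] algebra_simps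
          sum_negf[symmetric] del: sum_negf)
    also have "\<dots> = \<eta> t * g t - (\<eta> t)\<^sup>2"
      using b by (simp add: g_def h_def W_def left_diff_distrib sum_subtractf right_diff_distrib)
    finally show ?thesis .
  qed
  have "(\<Sum>t=1..T. \<eta> t * g t - (\<eta> t)\<^sup>2) \<le> (\<Sum>t=1..T. \<Psi> (Suc t) - \<Psi> t)"
    using inc by (intro sum_mono) auto
  also have "\<dots> = \<Psi> (Suc T) - \<Psi> 1"
    using sum_Suc_diff[of 1 T \<Psi>] by simp
  also have "\<Psi> (Suc T) \<le> 0"
    unfolding \<Psi>_def
  proof (rule sum_nonpos)
    fix i assume i: "i \<in> I"
    have "w (Suc T) i \<le> sum (w (Suc T)) I"
      using i assms(1) pos[of "Suc T"] by (intro member_le_sum) (auto simp: less_imp_le)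
    then have "ln (w (Suc T) i / sum (w (Suc T)) I) \<le> 0"
      using pos[of "Suc T" i] W_pos[of "Suc T"] i by simp
    then show "b i * ln (w (Suc T) i / sum (w (Suc T)) I) \<le> 0"
      using b i by (simp add: mult_nonneg_nonpos)
  qed
  also have "\<Psi> 1 = - ln (card I)"
  proof -
    have "sum (w 1) I = card I"
      using init by simp
    moreover have "card I > 0"
      using assms by (simp add: card_gt_0_iff)
    ultimately have "\<Psi> 1 = (\<Sum>i\<in>I. b i * - ln (card I))"
      unfolding \<Psi>_def using init by (intro sum.cong) (auto simp: ln_div)
    then show ?thesis
      by (simp add: b sum_distrib_right[symmetric] sum_negf)
  qed
  finally show ?thesis
    by (simp add: sum_subtractf g_def)
qed

text \<open>Markov's inequality at level \<open>\<tau> + \<epsilon>\<close>: the right-hand side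
  equals \<open>\<tau> / (\<tau> + \<epsilon>)\<close>.\<close>

lemma markov_count:
  fixes l :: "nat \<Rightarrow> real"
  assumes "\<And>t. l t \<ge> 0" "(\<Sum>t=1..T. l t) \<le> T * \<tau>" "\<tau> \<ge> 0" "\<epsilon> > 0" "T > 0"
  shows "card {t \<in> {1..T}. l t > \<tau> + \<epsilon>} / T \<le> 1 - \<epsilon> / (\<tau> + \<epsilon>)"
proof -
  let ?A = "{t \<in> {1..T}. l t > \<tau> + \<epsilon>}"
  have "card ?A * (\<tau> + \<epsilon>) = (\<Sum>t\<in>?A. \<tau> + \<epsilon>)"
    by simp
  also have "\<dots> \<le> sum l ?A"
    by (intro sum_mono) auto
  also have "\<dots> \<le> (\<Sum>t=1..T. l t)"
    using assms by (intro sum_mono2) auto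
  finally have "card ?A * (\<tau> + \<epsilon>) \<le> T * \<tau>"
    using assms by linarith
  then show ?thesis
    using assms by (simp add: field_simps)
qed

section \<open>Epochs and learning rates\<close>

text \<open>The truncation in \<open>nat\<close> puts the initial phase \<open>t \<le> T\<^sub>0\<close>, which has the same
  learning rate, into epoch 0.\<close>

definition epoch_index :: "nat \<Rightarrow> nat \<Rightarrow> nat" where
  "epoch_index p t = nat (\<lceil>log 2 (t / epoch_end p 0)\<rceil> - 1)"

context
  fixes p :: nat
  assumes p: "p \<ge> 3"
begin

text \<open>Since \<open>p \<ge> 3\<close> exceeds e. This makes the epoch ends positive and the
  epochs longer than one time step.\<close>

lemma ln_p_ge_1: "ln (real p) \<ge> 1"
proof -
  have "exp 1 \<le> (3::real)" by (rule exp_le)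
  also have "\<dots> \<le> p" using p by simp
  finally show ?thesis
    using p by (simp add: ln_ge_iff)
qed

lemma epoch_end_pos: "epoch_end p k > 0"
  using ln_p_ge_1 by (simp add: epoch_end_def)

lemma epoch_end_eq: "epoch_end p k = 2 ^ k * epoch_end p 0"
  by (simp add: epoch_end_def)

text \<open>Epoch \<open>k\<close> means \<open>2 ^ k < u \<le> 2 ^ Suc k\<close> for the rescaled
  time \<open>u\<close>, so \<open>k\<close> is the rounded-up logarithm of \<open>u\<close> minus
  1. Doubling \<open>u\<close> adds 1 to the logarithm; hence the offset 2 linking the threshold's
  logarithmic factor to the epoch index.\<close>

lemma epoch_index_bounds:
  assumes "real t > epoch_end p 0"
  shows "epoch_end p (epoch_index p t) < t" "t \<le> epoch_end p (Suc (epoch_index p t))"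
    and "\<lceil>log 2 (2 * real t / epoch_end p 0)\<rceil> = int (epoch_index p t) + 2"
proof -
  let ?T = "epoch_end p 0"
  define u where "u = t / ?T"
  have T: "?T > 0" by (rule epoch_end_pos)
  have u: "u > 1" using assms T by (simp add: u_def)
  then have "log 2 u > 0" by simp
  then have idx: "int (epoch_index p t) = \<lceil>log 2 u\<rceil> - 1"
    by (simp add: epoch_index_def u_def)
  then have "real (epoch_index p t) < log 2 u" "log 2 u \<le> real (Suc (epoch_index p t))"
    by linarith+
  then have "2 ^ epoch_index p t < u" "u \<le> 2 ^ Suc (epoch_index p t)"
    using u by (simp_all add: less_log_iff log_le_iff powr_realpow[symmetric] powr_add)
  then show "epoch_end p (epoch_index p t) < t" "t \<le> epoch_end p (Suc (epoch_index p t))"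
    using T by (simp_all add: epoch_end_eq[of "epoch_index p t"]
        epoch_end_eq[of "Suc (epoch_index p t)"] u_def field_simps)
  have "log 2 (2 * real t / ?T) = log 2 u + 1"
    using u by (simp add: log_mult u_def[symmetric] flip: times_divide_eq_right)
  then show "\<lceil>log 2 (2 * real t / ?T)\<rceil> = int (epoch_index p t) + 2"
    using idx by simp
qed

lemma epoch_index_early:
  assumes "real t \<le> epoch_end p 0"
  shows "epoch_index p t = 0"
proof (cases "t = 0")
  case False
  then have "log 2 (t / epoch_end p 0) \<le> 0"
    using assms epoch_end_pos[of 0] by simp
  then show ?thesis
    by (simp add: epoch_index_def ceiling_le_iff)
\<comment> \<open>At \<open>t = 0\<close> the default value \<open>ln 0 = 0\<close> gives -1, which
  \<open>nat\<close> truncates to 0.\<close>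
qed (simp add: epoch_index_def log_def)

lemma le_epoch_end_epoch_index: "t \<le> epoch_end p (Suc (epoch_index p t))"
proof (cases "real t \<le> epoch_end p 0")
  case True
  then show ?thesis
    using epoch_index_early[OF True] epoch_end_pos[of 0] epoch_end_eq[of 1] by simp
qed (use epoch_index_bounds in auto)

lemma epoch_index_mono: "t \<le> t' \<Longrightarrow> epoch_index p t \<le> epoch_index p t'"
proof (cases "t = 0")
  case False
  assume "t \<le> t'"
  then have "log 2 (t / epoch_end p 0) \<le> log 2 (t' / epoch_end p 0)"
    using False epoch_end_pos[of 0] by (simp add: divide_right_mono)
  then show ?thesis
    unfolding epoch_index_def by (intro nat_mono diff_right_mono ceiling_mono)
qed (simp add: epoch_index_def log_def)

text \<open>The factor \<open>ln p\<close> cancels against the one in \<open>epoch_end\<close>, so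
  the rate depends on the epoch index alone and inherits monotonicity from it.\<close>

lemma learning_rate_eq: "learning_rate p t = sqrt (1 / (4 * 2 ^ epoch_index p t))"
proof -
  let ?k = "epoch_index p t"
  have "ln (real p) / epoch_end p ?k = 1 / (4 * 2 ^ ?k)"
    using ln_p_ge_1 by (simp add: epoch_end_def)
  moreover have "learning_rate p t = sqrt (ln (real p) / epoch_end p ?k)"
  proof (cases "real t \<le> epoch_end p 0")
    case True
    then show ?thesis
      by (simp add: learning_rate_def epoch_index_early)
  next
    case False
    note bounds = epoch_index_bounds[of t]
    have "(THE k. epoch_end p k < t \<and> t \<le> epoch_end p (Suc k)) = ?k"
    proof (rule the_equality)
      fix k assume k: "epoch_end p k < t \<and> t \<le> epoch_end p (Suc k)"
      \<comment> \<open>Epoch ends increase strictly with the index, so two half-open epochs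
        containing \<open>t\<close> coincide.\<close>
      have less: "epoch_end p i < epoch_end p j \<Longrightarrow> i < j" for i j
        using epoch_end_pos[of 0] by (simp add: epoch_end_eq[of i] epoch_end_eq[of j])
      show "k = ?k"
        using k bounds False less[of k "Suc ?k"] less[of ?k "Suc k"] by linarith
    qed (use bounds False in auto)
    with False show ?thesis
      by (simp add: learning_rate_def)
  qed
  ultimately show ?thesis by simp
qed

lemma learning_rate_pos: "learning_rate p t > 0"
  by (simp add: learning_rate_eq)

lemma learning_rate_antimono: "t \<le> t' \<Longrightarrow> learning_rate p t' \<le> learning_rate p t"
  unfolding learning_rate_eq
  by (intro real_sqrt_le_mono divide_left_mono mult_left_mono power_increasing epoch_index_mono) auto

lemma learning_rate_le_half: "learning_rate p t \<le> 1 / 2"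
proof -
  have "1 / (4 * 2 ^ epoch_index p t) \<le> (1 / 2 :: real)\<^sup>2"
    by (simp add: field_simps power2_eq_square)
  then show ?thesis
    unfolding learning_rate_eq by (rule real_le_lsqrt[rotated]) simp
qed

text \<open>Skipping an epoch would put both \<open>epoch_end p (Suc k)\<close> and its double
  between \<open>t\<close> and \<open>t + 1\<close>, although this end is at least 1.\<close>

lemma epoch_index_Suc: "epoch_index p (Suc t) \<le> Suc (epoch_index p t)"
proof (rule ccontr)
  assume *: "\<not> ?thesis"
  let ?k = "epoch_index p t"
  have "real (Suc t) > epoch_end p 0"
    using epoch_index_early[of "Suc t"] * by (cases "real (Suc t) \<le> epoch_end p 0") auto
  then have "real (Suc t) > epoch_end p (epoch_index p (Suc t))"
    by (rule epoch_index_bounds)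
  moreover have "epoch_end p (epoch_index p (Suc t)) \<ge> epoch_end p (Suc (Suc ?k))"
    using * ln_p_ge_1 unfolding epoch_end_def
    by (intro mult_right_mono power_increasing) auto
  moreover have "epoch_end p (Suc (Suc ?k)) = 2 * epoch_end p (Suc ?k)"
    by (simp add: epoch_end_def)
  moreover have "epoch_end p (Suc ?k) \<ge> 1"
  proof -
    have "1 * 1 \<le> 2 ^ Suc ?k * (4 * ln (real p))"
      using ln_p_ge_1 by (intro mult_mono one_le_power) auto
    then show ?thesis by (simp add: epoch_end_def)
  qed
  moreover note le_epoch_end_epoch_index[of t]
  ultimately show False by simp
qed

text \<open>The right-hand side is the integral over \<open>[0, T]\<close> of the squared learning rate, a
  non-increasing step function, so non-integral epoch boundaries cost nothing.\<close>

lemma sum_learning_rate_squared: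
  "(\<Sum>t=1..T. (learning_rate p t)\<^sup>2)
     \<le> ln p * epoch_index p T + T / (4 * 2 ^ epoch_index p T)"
proof (induction T)
  case 0
  then show ?case by (simp add: epoch_index_def log_def)
next
  case (Suc T)
  let ?k = "epoch_index p T"
  have sq: "(learning_rate p (Suc T))\<^sup>2 = 1 / (4 * 2 ^ epoch_index p (Suc T))"
    by (simp add: learning_rate_eq)
  \<comment> \<open>On entering a new epoch the second term of the bound drops by
    \<open>T / (4 * 2 ^ Suc ?k)\<close>, at most \<open>ln p\<close> because \<open>T\<close> is
    still in epoch \<open>?k\<close>; the additional \<open>ln p\<close> in the first term pays for
    it.\<close>
  have "T \<le> 2 ^ Suc ?k * (4 * ln p)"
    using le_epoch_end_epoch_index[of T] by (simp add: epoch_end_def)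
  then have "T / (4 * 2 ^ ?k) \<le> ln p + T / (4 * 2 ^ Suc ?k)"
    by (simp add: field_simps)
  moreover have "epoch_index p (Suc T) = ?k \<or> epoch_index p (Suc T) = Suc ?k"
    using epoch_index_Suc[of T] epoch_index_mono[of T "Suc T"] by linarith
  ultimately show ?case
    using Suc sq by (auto simp: algebra_simps add_divide_distrib)
qed

text \<open>The left side is at most \<open>ln p * (?lg + 1)\<close>, and
  \<open>ln p \<le> learning_rate p T * sqrt (T * ln p)\<close> because the current epoch starts no
  later than \<open>T\<close>. The factor \<open>2 * sqrt 2\<close> absorbs the added 1.\<close>

lemma epoch_tradeoff:
  assumes T: "real T \<ge> epoch_end p 0"
  shows "ln p + (\<Sum>t=1..T. (learning_rate p t)\<^sup>2)
    \<le> learning_rate p T * (2 * sqrt 2 * \<lceil>log 2 (2 * real T / epoch_end p 0)\<rceil> * sqrt (T * ln p))"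
    (is "_ \<le> _ * (2 * sqrt 2 * real_of_int ?lg * _)")
proof -
  let ?k = "epoch_index p T" and ?L = "ln (real p)"
  have L: "?L \<ge> 1" by (rule ln_p_ge_1)
  have k: "2 ^ ?k * (4 * ?L) \<le> T"
  proof (cases "T = epoch_end p 0")
    case True
    then show ?thesis using epoch_index_early[of T] by (simp add: epoch_end_def)
  next
    case False
    then show ?thesis using T epoch_index_bounds(1)[of T] by (simp add: epoch_end_def)
  qed
  \<comment> \<open>At the boundary \<open>?lg = 1\<close> and the squares sum to at most
    \<open>?L\<close>. Beyond it they sum to at most \<open>(?k + 2) * ?L\<close>, and
    \<open>?lg = ?k + 2\<close>.\<close>
  have \<lambda>: "?lg \<ge> 1 \<and> ?L + (\<Sum>t=1..T. (learning_rate p t)\<^sup>2) \<le> ?L * (real_of_int ?lg + 1)"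
  proof (cases "T = epoch_end p 0")
    case True
    then have "?lg = 1" "?k = 0"
      using epoch_end_pos[of 0] epoch_index_early[of T] by simp_all
    moreover have "T / 4 = ?L"
      using True by (simp add: epoch_end_def)
    ultimately show ?thesis
      using sum_learning_rate_squared[of T] by simp
  next
    case False
    then have *: "T > epoch_end p 0" using T by simp
    have "T / (4 * 2 ^ ?k) \<le> 2 * ?L"
      using epoch_index_bounds(2)[OF *] by (simp add: epoch_end_def field_simps)
    then show ?thesis
      using sum_learning_rate_squared[of T] epoch_index_bounds(3)[OF *]
      by (simp add: algebra_simps)
  qed
  have "?L \<le> learning_rate p T * sqrt (T * ?L)"
  proof -
    have "?L\<^sup>2 \<le> 1 / (4 * 2 ^ ?k) * (T * ?L)"
      using k L by (simp add: power2_eq_square field_simps)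
    then have "?L \<le> sqrt (1 / (4 * 2 ^ ?k) * (T * ?L))"
      by (rule real_le_rsqrt)
    then show ?thesis
      by (simp only: learning_rate_eq real_sqrt_mult)
  qed
  moreover have "real_of_int ?lg + 1 \<le> 2 * sqrt 2 * real_of_int ?lg"
  proof -
    have "2 * 1 * real_of_int ?lg \<le> 2 * sqrt 2 * real_of_int ?lg"
      using \<lambda> by (intro mult_right_mono mult_left_mono) auto
    with \<lambda> show ?thesis by linarith
  qed
  ultimately have "?L * (real_of_int ?lg + 1)
      \<le> learning_rate p T * sqrt (T * ?L) * (2 * sqrt 2 * real_of_int ?lg)"
    using L \<lambda> learning_rate_pos[of T] by (intro mult_mono) auto
  with \<lambda> show ?thesis by (simp add: mult_ac)
qed

section \<open>Sign and limit of the loss threshold\<close>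

lemma loss_threshold_nonneg:
  assumes "real T \<ge> epoch_end p 0" "D \<ge> 0"
  shows "loss_threshold p D T \<ge> 0"
proof -
  have "log 2 (2 * real T / epoch_end p 0) \<ge> 0"
    using assms epoch_end_pos[of 0] by simp
  then have "0 \<le> \<lceil>log 2 (2 * real T / epoch_end p 0)\<rceil>"
    by simp
  then show ?thesis
    unfolding loss_threshold_def using assms ln_p_ge_1
    by (intro mult_nonneg_nonneg) auto
qed

text \<open>Replacing the ceiling by the logarithm plus 1 gives an upper bound of order log T over
  the square root of T.\<close>

lemma loss_threshold_tendsto_0:
  assumes "D \<ge> 0"
  shows "(\<lambda>T. loss_threshold p D T) \<longlonglongrightarrow> 0"
proof (rule tendsto_sandwich)
  let ?u = "\<lambda>T::nat. 2 * sqrt 2 * D * (log 2 (2 * real T / epoch_end p 0) + 1) * sqrt (ln p / T)"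
  have ev: "eventually (\<lambda>T::nat. real T \<ge> epoch_end p 0) sequentially"
    by real_asymp
  then show "eventually (\<lambda>T. 0 \<le> loss_threshold p D T) sequentially"
    by eventually_elim (use assms loss_threshold_nonneg in auto)
  show "eventually (\<lambda>T. loss_threshold p D T \<le> ?u T) sequentially"
    unfolding loss_threshold_def using assms ln_p_ge_1
    by (intro always_eventually allI mult_right_mono mult_left_mono) (linarith | simp)+
  have "?u \<longlonglongrightarrow> 0"
    using epoch_end_pos[of 0] ln_p_ge_1 unfolding log_def by real_asymp
  then show "?u \<longlonglongrightarrow> 0" .
qed simp

end

section \<open>Arrays, feedback bounds and schedulers\<close>

text \<open>The triangle and its mirror image cover the square and meet in the diagonal.\<close>

lemma card_upper: "card (upper :: ('n::{finite,linorder} \<times> 'n) set) = num_entries CARD('n)"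
proof -
  let ?U = "upper :: ('n \<times> 'n) set"
  have "card ?U + card (prod.swap ` ?U) = card (?U \<union> prod.swap ` ?U) + card (?U \<inter> prod.swap ` ?U)"
    by (rule card_Un_Int) auto
  moreover have "card (prod.swap ` ?U) = card ?U"
    by (rule card_image) simp
  moreover have "?U \<union> prod.swap ` ?U = UNIV \<times> UNIV"
    by (auto simp: upper_def image_iff)
  moreover have "?U \<inter> prod.swap ` ?U = (\<lambda>i. (i, i)) ` UNIV"
    by (auto simp: upper_def)
  moreover have "card ((\<lambda>i::'n. (i, i)) ` UNIV) = CARD('n)"
    by (rule card_image) (simp add: inj_on_def)
  ultimately have "2 * card ?U = CARD('n) * (CARD('n) + 1)"
    by (simp add: card_cartesian_product)
  then show ?thesis
    by (simp add: num_entries_def)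
qed

text \<open>The total is only bounded by 1 because an empty backlog normalizes to 0.\<close>

lemma normalized_bounds:
  fixes x :: "('n::finite) nvec"
  shows "normalized x $ i \<ge> 0" "(\<Sum>i\<in>UNIV. normalized x $ i) \<le> 1"
proof -
  show "normalized x $ i \<ge> 0"
    by (simp add: normalized_def real_vec_def sum_nonneg)
  show "(\<Sum>i\<in>UNIV. normalized x $ i) \<le> 1"
  proof (cases "(\<Sum>i\<in>UNIV. x $ i) = 0")
    case False
    have "(\<Sum>i\<in>UNIV. normalized x $ i) = (\<Sum>i\<in>UNIV. real (x $ i)) / real (\<Sum>i\<in>UNIV. x $ i)"
      using False
      by (simp add: normalized_def real_vec_def divide_inverse_commute sum_distrib_left del: of_nat_sum)
    also have "\<dots> = 1"
      using False by (metis divide_self of_nat_eq_0_iff of_nat_sum)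
    finally show ?thesis by simp
  qed (simp add: normalized_def)
qed

text \<open>Each product is bounded by an entry of \<open>y\<close>, and the entries at
  \<open>i\<close> and \<open>j\<close> together have mass at most 1. The set \<open>{i, j}\<close>
  collapses on the diagonal, so one estimate serves both cases.\<close>

lemma abs_q_ij_le_1:
  assumes u: "\<And>i. \<bar>u $ i\<bar> \<le> 1" and y: "\<And>i. y $ i \<ge> 0" "(\<Sum>i\<in>UNIV. y $ i) \<le> 1"
  shows "\<bar>q_ij i j u y\<bar> \<le> 1"
proof -
  have prod: "\<bar>u $ i * y $ j\<bar> \<le> y $ j" for i j
    using u[of i] y(1)[of j] by (simp add: abs_mult mult_left_le_one_le)
  have "sum (($) y) {i, j} \<le> sum (($) y) UNIV"
    using y by (intro sum_mono2) auto
  then have le: "sum (($) y) {i, j} \<le> 1"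
    using y by simp
  show ?thesis
  proof (cases "i = j")
    case True
    then show ?thesis
      using le prod[of i i] by (simp add: q_ij_def)
  next
    case False
    then show ?thesis
      using le prod[of i j] prod[of j i] by (simp add: q_ij_def)
  qed
qed

lemma abs_mw_feedback_le_1:
  assumes "\<And>i. y $ i \<ge> 0" "(\<Sum>i\<in>UNIV. y $ i) \<le> 1"
  shows "\<bar>mw_feedback \<delta> y i j\<bar> \<le> 1"
proof (cases "\<delta> = 0")
  case False
  then have pos: "infnorm \<delta> > 0"
    by (simp add: infnorm_pos_lt)
  have "\<bar>(\<delta> /\<^sub>R infnorm \<delta>) $ k\<bar> \<le> 1" for k
    using component_le_infnorm_cart[of \<delta> k] pos by (simp add: abs_mult field_simps)
  then have "\<bar>q_ij i j (\<delta> /\<^sub>R infnorm \<delta>) y\<bar> \<le> 1"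
    using assms by (rule abs_q_ij_le_1)
  then show ?thesis
    using False by (auto simp: mw_feedback_def sgn_ij_def abs_mult)
qed (simp add: mw_feedback_def)

text \<open>Undoes the normalization in the feedback, so that the loss becomes
  \<open>infnorm \<delta>\<close> times the regret term bounded by \<open>mw_regret\<close>.\<close>

lemma sgn_q_ij_eq_infnorm_feedback:
  "sgn_ij i j * q_ij i j \<delta> y = infnorm \<delta> * mw_feedback \<delta> y i j"
proof (cases "\<delta> = 0")
  case False
  then have "infnorm \<delta> \<noteq> 0"
    by (simp add: infnorm_eq_0)
  then show ?thesis
    using False by (simp add: mw_feedback_def q_ij_def divide_simps algebra_simps)
qed (simp add: q_ij_def mw_feedback_def)

lemma score_diff: "score \<beta> (u - v) y = score \<beta> u y - score \<beta> v y"
  unfolding score_def sum_subtractf[symmetric]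
  by (rule sum.cong) (auto simp: q_ij_def algebra_simps)

lemma score_diff_array:
  "(\<Sum>(i, j)\<in>upper. sgn_ij i j * (\<beta> i j - \<gamma> i j) * q_ij i j u y) = score \<beta> u y - score \<gamma> u y"
  unfolding score_def sum_subtractf[symmetric]
  by (rule sum.cong) (auto simp: algebra_simps)

lemma scheduler_maximizes:
  assumes "finite S" "S \<noteq> {}" "linear_order_on S r"
  shows "scheduler S r y \<beta> \<in> S"
    and "s \<in> S \<Longrightarrow> score \<beta> (real_vec s) y \<le> score \<beta> (real_vec (scheduler S r y \<beta>)) y"
proof -
  have "scheduler S r y \<beta> \<in> maximizers S (\<lambda>s. score \<beta> (real_vec s) y)"
    unfolding scheduler_def argmax_tie_def using theI'[OF argmax_tie_unique[OF assms]] by blast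
  then show "scheduler S r y \<beta> \<in> S"
    and "s \<in> S \<Longrightarrow> score \<beta> (real_vec s) y \<le> score \<beta> (real_vec (scheduler S r y \<beta>)) y"
    by (auto simp: maximizers_def)
qed

lemma infnorm_le_diam_inf:
  assumes "finite S" "u \<in> S" "v \<in> S"
  shows "infnorm (real_vec u - real_vec v) \<le> diam_inf S"
  unfolding diam_inf_def using assms by (intro Max_ge) auto

text \<open>Tests the quadratic form on a basis vector; this gives nonnegative diagonal entries of
  the expert's array.\<close>

lemma pos_def_matrix_diag_pos:
  assumes "pos_def_matrix B"
  shows "B $ i $ i > 0"
proof -
  have "axis i 1 \<bullet> (B *v axis i 1) > 0"
    using assms unfolding pos_def_matrix_def by (metis axis_eq_0_iff zero_neq_one)
  then show ?thesis
    by (simp add: matrix_vector_mult_basis column_def inner_axis')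
qed

section \<open>Total loss of the algorithm\<close>

text \<open>The loss factors as \<open>infnorm (\<delta> t) * g t\<close>. As
  \<open>g t \<ge> 0\<close>, the first factor can be replaced by the diameter, and in the weighted
  regret every \<open>\<eta> t\<close> by the smallest rate \<open>\<eta> T\<close>, which then
  cancels against \<open>epoch_tradeoff\<close>.\<close>

lemma mw_loss_sum_le:
  fixes S :: "('n::{finite,linorder}) nvec set" and b :: "'n array"
  assumes "CARD('n) \<ge> 2"
    and S: "finite S" "S \<noteq> {}" "linear_order_on S r"
    and b: "\<And>i j. b i j \<ge> 0" "(\<Sum>(i, j)\<in>upper. b i j) = 1"
    and y: "\<And>t i. y t $ i \<ge> 0" "\<And>t. (\<Sum>i\<in>UNIV. y t $ i) \<le> 1"
    and s: "\<And>t. s t = scheduler S r (y t) b"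
  defines "p \<equiv> num_entries CARD('n)"
  shows "mw_loss S r b y s t \<ge> 0"
    and "real T \<ge> epoch_end p 0 \<Longrightarrow>
      (\<Sum>t=1..T. mw_loss S r b y s t) \<le> T * loss_threshold p (diam_inf S) T"
proof -
  have "2 * (2 + 1) \<le> CARD('n) * (CARD('n) + 1)"
    using assms(1) by (intro mult_mono) auto
  then have p: "p \<ge> 3"
    by (simp add: p_def num_entries_def)
  define w where "w = mw_weights S r y s"
  define \<delta> where "\<delta> = (\<lambda>t. decision_gap S r (w t) (y t) (s t))"
  define m where "m = (\<lambda>t. mw_feedback (\<delta> t) (y t))"
  define \<eta> where "\<eta> = learning_rate p"
  define l where "l = mw_loss S r b y s"
  define g where "g = (\<lambda>t. \<Sum>(i, j)\<in>upper. (normalized_array (w t) i j - b i j) * m t i j)"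
  have \<delta>: "\<delta> t = real_vec (scheduler S r (y t) (normalized_array (w t))) - real_vec (s t)" for t
    by (simp add: \<delta>_def decision_gap_def)
  have l_eq: "l t = infnorm (\<delta> t) * g t" for t
    unfolding l_def mw_loss_def Let_def g_def m_def \<delta>_def w_def sum_distrib_left
    by (rule sum.cong) (auto simp flip: sgn_q_ij_eq_infnorm_feedback)
  have l_nonneg: "l t \<ge> 0" for t
  proof -
    have "l t = score (normalized_array (w t)) (\<delta> t) (y t) - score b (\<delta> t) (y t)"
      unfolding l_def mw_loss_def Let_def \<delta>_def w_def score_diff_array ..
    \<comment> \<open>\<open>\<delta> t\<close> is the learner's choice minus the expert's: the
      learner's array favours the former, the expert's array the latter.\<close>
    moreover have "score (normalized_array (w t)) (\<delta> t) (y t) \<ge> 0"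
      using scheduler_maximizes[OF S] by (simp add: \<delta> score_diff s)
    moreover have "score b (\<delta> t) (y t) \<le> 0"
      using scheduler_maximizes[OF S] by (simp add: \<delta> score_diff s)
    ultimately show ?thesis by simp
  qed
  then show "mw_loss S r b y s t \<ge> 0"
    by (simp add: l_def)
  have g_nonneg: "g t \<ge> 0" for t
  proof (cases "\<delta> t = 0")
    case True
    then show ?thesis by (simp add: g_def m_def mw_feedback_def case_prod_unfold)
  next
    case False
    then have "infnorm (\<delta> t) > 0"
      by (simp add: infnorm_pos_lt)
    then show ?thesis
      using l_nonneg[of t] by (simp add: l_eq zero_le_mult_iff)
  qed
  have D: "infnorm (\<delta> t) \<le> diam_inf S" for t
    unfolding \<delta> s by (intro infnorm_le_diam_inf scheduler_maximizes S)
  have D_nonneg: "diam_inf S \<ge> 0"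
    using D[of 0] infnorm_pos_le[of "\<delta> 0"] by linarith
  have "l t \<le> diam_inf S * g t" for t
    unfolding l_eq using D g_nonneg by (rule mult_right_mono)
  then have sum_l: "(\<Sum>t=1..T. l t) \<le> diam_inf S * (\<Sum>t=1..T. g t)" for T
    unfolding sum_distrib_left by (rule sum_mono)
  assume T: "real T \<ge> epoch_end p 0"
  \<comment> \<open>Uncurried arrays become weight vectors indexed by \<open>upper\<close>, the form
    that \<open>mw_regret\<close> takes.\<close>
  have "(\<Sum>t=1..T. \<eta> t * (\<Sum>i\<in>upper. (case_prod (w t) i / sum (case_prod (w t)) upper
            - case_prod b i) * case_prod (m t) i))
        \<le> ln (card (upper :: ('n \<times> 'n) set)) + (\<Sum>t=1..T. (\<eta> t)\<^sup>2)"
  proof (rule mw_regret)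
    show "upper \<noteq> ({} :: ('n \<times> 'n) set)"
      by (auto simp: upper_def)
    \<comment> \<open>The update starts from index 1; the dummy index 0 is followed by the initial
      weights without an update.\<close>
    show "case_prod (w (Suc t)) i = case_prod (w t) i * (1 - \<eta> t * case_prod (m t) i)"
      if "t \<ge> 1" for t i
      using that by (cases t) (auto simp: w_def \<eta>_def m_def \<delta>_def p_def Let_def split: prod.split)
    show "\<bar>case_prod (m t) i\<bar> \<le> 1" for t i
      unfolding m_def using abs_mw_feedback_le_1[OF y] by (auto split: prod.split)
    show "0 < \<eta> t" "\<eta> t \<le> 1 / 2" for t
      unfolding \<eta>_def by (intro learning_rate_pos learning_rate_le_half p)+
    show "case_prod b i \<ge> 0" for i
      using b by (auto split: prod.split)
    show "sum (case_prod b) upper = 1"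
      by (rule b)
    show "case_prod (w 1) i = 1" for i
      by (simp add: w_def split: prod.split)
  qed auto
  also have "(\<lambda>t. \<Sum>i\<in>upper. (case_prod (w t) i / sum (case_prod (w t)) upper
            - case_prod b i) * case_prod (m t) i) = g"
    by (auto simp: g_def normalized_array_def fun_eq_iff case_prod_unfold)
  finally have regret: "(\<Sum>t=1..T. \<eta> t * g t) \<le> ln p + (\<Sum>t=1..T. (\<eta> t)\<^sup>2)"
    by (simp add: card_upper p_def)
  have "\<eta> T * (\<Sum>t=1..T. g t) \<le> (\<Sum>t=1..T. \<eta> t * g t)"
    unfolding sum_distrib_left \<eta>_def using g_nonneg
    by (intro sum_mono mult_right_mono learning_rate_antimono p) auto
  also note regret
  also have "ln p + (\<Sum>t=1..T. (\<eta> t)\<^sup>2)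
      \<le> \<eta> T * (2 * sqrt 2 * \<lceil>log 2 (2 * real T / epoch_end p 0)\<rceil> * sqrt (T * ln p))"
    unfolding \<eta>_def using p T by (rule epoch_tradeoff)
  finally have "(\<Sum>t=1..T. g t)
      \<le> 2 * sqrt 2 * \<lceil>log 2 (2 * real T / epoch_end p 0)\<rceil> * sqrt (T * ln p)"
    using learning_rate_pos[OF p, of T] by (simp add: \<eta>_def)
  then have "(\<Sum>t=1..T. l t) \<le> diam_inf S
      * (2 * sqrt 2 * \<lceil>log 2 (2 * real T / epoch_end p 0)\<rceil> * sqrt (T * ln p))"
    using sum_l[of T] D_nonneg by (meson mult_left_mono order_trans)
  also have "\<dots> = T * loss_threshold p (diam_inf S) T"
  proof -
    have "T > 0"
      using T epoch_end_pos[OF p, of 0] by (cases T) auto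
    \<comment> \<open>Turns the bound on the total into \<open>T\<close> times a bound on the
      average.\<close>
    then have "sqrt (T * ln p) = T * sqrt (ln p / T)"
      by (simp add: real_sqrt_mult real_sqrt_divide field_simps)
    then show ?thesis
      by (simp add: loss_threshold_def)
  qed
  finally show "(\<Sum>t=1..T. mw_loss S r b y s t) \<le> T * loss_threshold p (diam_inf S) T"
    by (simp add: l_def)
qed

section \<open>Frequency of large losses\<close>

theorem theorem3:
  fixes S :: "('n::{finite,linorder}) nvec set" and r :: "'n nvec rel"
    and B :: "'n rmat" and c :: real
    and x a s :: "nat \<Rightarrow> 'n nvec"
    and p :: nat and D :: real and b :: "'n array"
    and y :: "nat \<Rightarrow> 'n rvec" and l :: "nat \<Rightarrow> real"
  assumes "CARD('n) \<ge> 2"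
    and "finite S" and "S \<noteq> {}" and "linear_order_on S r"
    and "pos_def_matrix B" and "\<And>i j. i \<noteq> j \<Longrightarrow> B $ i $ j \<le> 0"
    and "c > 0" and "(\<Sum>(i, j)\<in>upper. expert_array c B i j) = 1"
    and "\<And>t. s t = expert_decision S r B (x t)"
    and "\<And>t i. x (Suc t) $ i = x t $ i - min (s t $ i) (x t $ i) + a t $ i"
  defines "p \<equiv> num_entries CARD('n)"
    and "D \<equiv> diam_inf S"
    and "b \<equiv> expert_array c B"
    and "y \<equiv> (\<lambda>t. normalized (x t))"
    and "l \<equiv> mw_loss S r b y s"
  shows "(\<forall>\<epsilon>>0. \<forall>T::nat. real T \<ge> epoch_end p 0 \<longrightarrow>
            excess_fraction p D l T \<epsilon> \<le> 1 - \<epsilon> / (loss_threshold p D T + \<epsilon>))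
       \<and> (\<forall>\<epsilon>>0. (\<lambda>T. excess_fraction p D l T \<epsilon>) \<longlonglongrightarrow> 0)"
proof -
  have "2 * (2 + 1) \<le> CARD('n) * (CARD('n) + 1)"
    using assms(1) by (intro mult_mono) auto
  then have p: "p \<ge> 3"
    by (simp add: p_def num_entries_def)
  \<comment> \<open>Diagonal entries are positive by positive definiteness; off the diagonal the
    sign flip in \<open>expert_array\<close> meets nonpositive entries of \<open>B\<close>.\<close>
  have b: "b i j \<ge> 0" for i j
    unfolding b_def expert_array_def
    using pos_def_matrix_diag_pos[OF assms(5), of i] assms(6)[of i j] \<open>c > 0\<close>
    by (auto simp: mult_le_0_iff)
  have y: "y t $ i \<ge> 0" "(\<Sum>i\<in>UNIV. y t $ i) \<le> 1" for t i
    unfolding y_def by (rule normalized_bounds)+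
  have s: "s t = scheduler S r (y t) b" for t
    unfolding assms(9) y_def b_def by (rule expert_decision_eq_scheduler[OF assms(5,7)])
  note loss = mw_loss_sum_le[where y = y and s = s, OF assms(1-4) b assms(8)[folded b_def] y s,
      folded p_def D_def l_def]
  have D: "D \<ge> 0"
    using infnorm_le_diam_inf[OF assms(2)] assms(3) infnorm_pos_le
    unfolding D_def by (meson all_not_in_conv order_trans)
  have bound: "excess_fraction p D l T \<epsilon> \<le> 1 - \<epsilon> / (loss_threshold p D T + \<epsilon>)"
    if "\<epsilon> > 0" "real T \<ge> epoch_end p 0" for \<epsilon> T
  proof -
    have "T > 0"
      using that epoch_end_pos[OF p, of 0] by (cases T) auto
    then show ?thesis
      unfolding excess_fraction_def
      using that loss loss_threshold_nonneg[OF p _ D] by (intro markov_count) auto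
  qed
  moreover have "(\<lambda>T. excess_fraction p D l T \<epsilon>) \<longlonglongrightarrow> 0" if "\<epsilon> > 0" for \<epsilon>
  proof (rule tendsto_sandwich)
    show "eventually (\<lambda>T. 0 \<le> excess_fraction p D l T \<epsilon>) sequentially"
      by (simp add: excess_fraction_def)
    have "eventually (\<lambda>T::nat. real T \<ge> epoch_end p 0) sequentially"
      by real_asymp
    then show "eventually (\<lambda>T. excess_fraction p D l T \<epsilon>
        \<le> 1 - \<epsilon> / (loss_threshold p D T + \<epsilon>)) sequentially"
      by eventually_elim (use bound that in auto)
    \<comment> \<open>With \<open>\<epsilon>\<close> fixed and the threshold vanishing, the
      finite-horizon bound itself tends to 0.\<close>
    have "(\<lambda>T. 1 - \<epsilon> / (loss_threshold p D T + \<epsilon>)) \<longlonglongrightarrow> 1 - \<epsilon> / (0 + \<epsilon>)"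
      using that by (intro tendsto_intros loss_threshold_tendsto_0[OF p D]) auto
    then show "(\<lambda>T. 1 - \<epsilon> / (loss_threshold p D T + \<epsilon>)) \<longlonglongrightarrow> 0"
      using that by simp
  qed simp
  ultimately show ?thesis
    by blast
qed

end
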